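(* Let $(X,\mu,\mathcal{E},\mathcal{F})$ be a Dirichlet space whose heat kernel satisfies $p_t(x,y)\le C_ht^{-\beta}$ for $\mu\times\mu$-a.e. $(x,y)\in X\times X$ and every $t>0$, for some constants $C_h>0$ and $\beta>0$. Assume that condition $(\mathrm{PPI}_1)$ is satisfied and that $\alpha_1=\beta$. Then there exists a constant $C>0$ such that for every $f\in BV(\mathcal{E})$, $$\|f\|_{L^\infty(X,\mu)}\le C\,\mathbf{Var}_{\mathcal{E}}(f).$$
   Context: $X$ is a good measurable space (like a Polish or Radon space) with a $\sigma$-finite measure $\mu$ supported on $X$, and $(\mathcal{E},\mathcal{F})$, $\mathcal{F}=\mathrm{dom}\,\mathcal{E}$, is a Dirichlet form on $L^2(X,\mu)$. Its heat semigroup $\{P_t\}_{t\ge0}$, extended to all $L^p(X,\mu)$, $1\le p\le\infty$, is assumed conservative ($P_t1=1$), and it admits a measurable heat kernel $p_t(x,y)$. For $\alpha\ge0$ (with $P_t(|f-f(y)|)(y)$ meaning $P_t$ applied to $x\mapsto|f(x)-f(y)|$, evaluated at $y$), $$\mathbf{B}^{1,\alpha}(X)=\Big\{f\in L^1(X,\mu):\limsup_{t\to0^+}t^{-\alpha}\int_XP_t(|f-f(y)|)(y)\,d\mu(y)<\infty\Big\}.$$ Set $\alpha_1=\sup\{\alpha>0:\mathbf{B}^{1,\alpha}(X)\text{ contains non a.e. constant functions}\}$, $BV(\mathcal{E})=\mathbf{B}^{1,\alpha_1}(X)$, and for $f\in BV(\mathcal{E})$ $$\mathbf{Var}_{\mathcal{E}}(f)=\liminf_{t\to0^+}t^{-\alpha_1}\int_XP_t(|f-f(y)|)(y)\,d\mu(y).$$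 Condition $(\mathrm{PPI}_1)$: there is a constant $C_1>0$ such that $\|P_tf-f\|_{L^1(X,\mu)}\le C_1\,t^{\alpha_1}\,\mathbf{Var}_{\mathcal{E}}(f)$ for every $t\ge0$ and $f\in BV(\mathcal{E})$. *)

theory Defs
  imports "HOL-Probability.Probability"
begin

section \<open>Good measurable spaces\<close>

text \<open>
  In the sense of Bakry--Gentil--Ledoux: the sigma-algebra is countably generated and the measure
  decomposition (disintegration) theorem holds on the product. Polish spaces with their Borel
  sigma-algebra are the model case.
\<close>

definition countably_generated :: "'a measure \<Rightarrow> bool" where
  "countably_generated M \<longleftrightarrow>
     (\<exists>A. countable A \<and> A \<subseteq> Pow (space M) \<and> sets M = sigma_sets (space M) A)"

definition measure_decomposition :: "'a measure \<Rightarrow> bool" where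
  "measure_decomposition M \<longleftrightarrow>
     (\<forall>N. prob_space N \<and> sets N = sets (M \<Otimes>\<^sub>M M) \<longrightarrow>
       (\<exists>k \<in> M \<rightarrow>\<^sub>M prob_algebra M. \<forall>A\<in>sets M. \<forall>B\<in>sets M.
          emeasure N (A \<times> B) = (\<integral>\<^sup>+x\<in>A. emeasure (k x) B \<partial>distr N M fst)))"

definition good_measurable_space :: "'a measure \<Rightarrow> bool" where
  "good_measurable_space M \<longleftrightarrow> countably_generated M \<and> measure_decomposition M"

section \<open>Lebesgue spaces\<close>

text \<open>
  Elements of \<open>L\<^sup>p\<close> are represented by functions; equality in \<open>L\<^sup>p\<close> is equality almost everywhere.
  The exponent ranges over \<open>[1,\<infinity>]\<close>, and the norm takes the value \<open>\<infinity>\<close> outside \<open>L\<^sup>p\<close>.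
\<close>

definition Lp_norm :: "'a measure \<Rightarrow> ennreal \<Rightarrow> ('a \<Rightarrow> real) \<Rightarrow> ennreal" where
  "Lp_norm M q f =
     (if q = \<infinity> then esssup M (\<lambda>x. ennreal \<bar>f x\<bar>)
      else let I = \<integral>\<^sup>+x. ennreal (\<bar>f x\<bar> powr enn2real q) \<partial>M
           in if I = \<infinity> then \<infinity> else ennreal (enn2real I powr (1 / enn2real q)))"

definition Lp :: "'a measure \<Rightarrow> ennreal \<Rightarrow> ('a \<Rightarrow> real) set" where
  "Lp M q = {f \<in> borel_measurable M. Lp_norm M q f < \<infinity>}"

definition linear_contraction_on_Lp ::
    "'a measure \<Rightarrow> ennreal \<Rightarrow> (('a \<Rightarrow> real) \<Rightarrow> 'a \<Rightarrow> real) \<Rightarrow> bool" where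
  "linear_contraction_on_Lp M q T \<longleftrightarrow>
     (\<forall>f\<in>Lp M q. T f \<in> Lp M q \<and> Lp_norm M q (T f) \<le> Lp_norm M q f) \<and>
     (\<forall>f\<in>Lp M q. \<forall>g\<in>Lp M q. \<forall>a b.
        AE x in M. T (\<lambda>x. a * f x + b * g x) x = a * T f x + b * T g x)"

section \<open>Dirichlet forms and their heat semigroups\<close>

definition form_energy1 ::
    "'a measure \<Rightarrow> (('a \<Rightarrow> real) \<Rightarrow> ('a \<Rightarrow> real) \<Rightarrow> real) \<Rightarrow> ('a \<Rightarrow> real) \<Rightarrow> real" where
  "form_energy1 M \<E> f = \<E> f f + (\<integral>x. (f x)\<^sup>2 \<partial>M)"

locale dirichlet_form =
  fixes M :: "'a measure"
    and \<E> :: "('a \<Rightarrow> real) \<Rightarrow> ('a \<Rightarrow> real) \<Rightarrow> real"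
    and \<F> :: "('a \<Rightarrow> real) set"
  assumes dom_L2: "\<F> \<subseteq> Lp M 2"
    and dom_AE: "\<lbrakk>f \<in> \<F>; g \<in> borel_measurable M; AE x in M. f x = g x\<rbrakk> \<Longrightarrow> g \<in> \<F>"
    and dom_zero: "(\<lambda>_. 0) \<in> \<F>"
    and dom_lin: "\<lbrakk>f \<in> \<F>; g \<in> \<F>\<rbrakk> \<Longrightarrow> (\<lambda>x. a * f x + b * g x) \<in> \<F>"
    and dom_dense: "\<lbrakk>f \<in> Lp M 2; \<epsilon> > 0\<rbrakk> \<Longrightarrow> \<exists>g\<in>\<F>. Lp_norm M 2 (\<lambda>x. f x - g x) < \<epsilon>"
    and form_AE: "\<lbrakk>f \<in> \<F>; g \<in> \<F>; h \<in> \<F>; AE x in M. f x = g x\<rbrakk> \<Longrightarrow> \<E> f h = \<E> g h"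
    and form_lin: "\<lbrakk>f \<in> \<F>; g \<in> \<F>; h \<in> \<F>\<rbrakk> \<Longrightarrow>
                     \<E> (\<lambda>x. a * f x + b * g x) h = a * \<E> f h + b * \<E> g h"
    and form_sym: "\<lbrakk>f \<in> \<F>; g \<in> \<F>\<rbrakk> \<Longrightarrow> \<E> f g = \<E> g f"
    and form_nonneg: "f \<in> \<F> \<Longrightarrow> 0 \<le> \<E> f f"
    and form_closed: "\<lbrakk>\<And>n. u n \<in> \<F>;
                       \<And>\<epsilon>::real. \<epsilon> > 0 \<Longrightarrow>
                         \<exists>N. \<forall>m\<ge>N. \<forall>n\<ge>N. form_energy1 M \<E> (\<lambda>x. u m x - u n x) < \<epsilon>\<rbrakk> \<Longrightarrow>
                     \<exists>v\<in>\<F>. (\<lambda>n. form_energy1 M \<E> (\<lambda>x. u n x - v x)) \<longlonglongrightarrow> 0"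
    and form_markov: "f \<in> \<F> \<Longrightarrow>
                        (\<lambda>x. min (max (f x) 0) 1) \<in> \<F> \<and>
                        \<E> (\<lambda>x. min (max (f x) 0) 1) (\<lambda>x. min (max (f x) 0) 1) \<le> \<E> f f"

text \<open>
  The graphs of the (nonpositive) generator of a form and of the infinitesimal generator of a
  semigroup on \<open>L\<^sup>2\<close>. The heat semigroup of a Dirichlet form is the self-adjoint, strongly
  continuous contraction semigroup for which both agree.
\<close>

definition form_generator ::
    "'a measure \<Rightarrow> (('a \<Rightarrow> real) \<Rightarrow> ('a \<Rightarrow> real) \<Rightarrow> real) \<Rightarrow> ('a \<Rightarrow> real) set \<Rightarrow>
     ('a \<Rightarrow> real) \<Rightarrow> ('a \<Rightarrow> real) \<Rightarrow> bool" where
  "form_generator M \<E> \<F> f h \<longleftrightarrow>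
     f \<in> \<F> \<and> h \<in> Lp M 2 \<and> (\<forall>g\<in>\<F>. \<E> f g = - (\<integral>x. h x * g x \<partial>M))"

definition semigroup_generator ::
    "'a measure \<Rightarrow> (real \<Rightarrow> ('a \<Rightarrow> real) \<Rightarrow> 'a \<Rightarrow> real) \<Rightarrow> ('a \<Rightarrow> real) \<Rightarrow> ('a \<Rightarrow> real) \<Rightarrow> bool" where
  "semigroup_generator M P f h \<longleftrightarrow>
     f \<in> Lp M 2 \<and> h \<in> Lp M 2 \<and>
     ((\<lambda>t. Lp_norm M 2 (\<lambda>x. (P t f x - f x) / t - h x)) \<longlongrightarrow> 0) (at_right 0)"

locale heat_semigroup = dirichlet_form M \<E> \<F>
  for M :: "'a measure" and \<E> \<F> +
  fixes P :: "real \<Rightarrow> ('a \<Rightarrow> real) \<Rightarrow> 'a \<Rightarrow> real"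
  assumes contraction_L2: "0 \<le> t \<Longrightarrow> linear_contraction_on_Lp M 2 (P t)"
    and semigroup_0: "f \<in> Lp M 2 \<Longrightarrow> AE x in M. P 0 f x = f x"
    and semigroup_add: "\<lbrakk>0 \<le> s; 0 \<le> t; f \<in> Lp M 2\<rbrakk> \<Longrightarrow> AE x in M. P (s + t) f x = P s (P t f) x"
    and strongly_continuous: "f \<in> Lp M 2 \<Longrightarrow>
           ((\<lambda>t. Lp_norm M 2 (\<lambda>x. P t f x - f x)) \<longlongrightarrow> 0) (at_right 0)"
    and self_adjoint: "\<lbrakk>0 \<le> t; f \<in> Lp M 2; g \<in> Lp M 2\<rbrakk> \<Longrightarrow>
           (\<integral>x. P t f x * g x \<partial>M) = (\<integral>x. f x * P t g x \<partial>M)"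
    and generator_eq: "semigroup_generator M P f h \<longleftrightarrow> form_generator M \<E> \<F> f h"

text \<open>
  The extension to all \<open>L\<^sup>q\<close>: being a single operator on functions, \<open>P t\<close> acts consistently on the
  intersections of the \<open>L\<^sup>q\<close>. For \<open>q < \<infinity>\<close> contractivity then determines it by density of
  \<open>L\<^sup>q \<inter> L\<^sup>2\<close>, and on \<open>L\<^sup>\<infinity>\<close> it is the dual of the operator on \<open>L\<^sup>1\<close>.
\<close>

definition extended_to_all_Lp ::
    "'a measure \<Rightarrow> (real \<Rightarrow> ('a \<Rightarrow> real) \<Rightarrow> 'a \<Rightarrow> real) \<Rightarrow> bool" where
  "extended_to_all_Lp M P \<longleftrightarrow>
     (\<forall>t\<ge>0. \<forall>q\<ge>1. linear_contraction_on_Lp M q (P t)) \<and>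
     (\<forall>t\<ge>0. \<forall>f\<in>Lp M \<infinity>. \<forall>g\<in>Lp M 1. (\<integral>x. P t f x * g x \<partial>M) = (\<integral>x. f x * P t g x \<partial>M))"

definition conservative ::
    "'a measure \<Rightarrow> (real \<Rightarrow> ('a \<Rightarrow> real) \<Rightarrow> 'a \<Rightarrow> real) \<Rightarrow> bool" where
  "conservative M P \<longleftrightarrow> (\<forall>t\<ge>0. AE x in M. P t (\<lambda>_. 1) x = 1)"

definition heat_kernel ::
    "'a measure \<Rightarrow> (real \<Rightarrow> ('a \<Rightarrow> real) \<Rightarrow> 'a \<Rightarrow> real) \<Rightarrow> (real \<Rightarrow> 'a \<Rightarrow> 'a \<Rightarrow> real) \<Rightarrow> bool" where
  "heat_kernel M P p \<longleftrightarrow>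
     (\<forall>t>0. (\<lambda>(x, y). p t x y) \<in> borel_measurable (M \<Otimes>\<^sub>M M) \<and>
        (\<forall>x\<in>space M. \<forall>y\<in>space M. 0 \<le> p t x y) \<and>
        (\<forall>f\<in>Lp M 2. AE x in M. integrable M (\<lambda>y. p t x y * f y) \<and>
           P t f x = (\<integral>y. p t x y * f y \<partial>M)))"

locale dirichlet_space = sigma_finite_measure M + heat_semigroup M \<E> \<F> P
  for M :: "'a measure" and \<E> \<F> P +
  fixes p :: "real \<Rightarrow> 'a \<Rightarrow> 'a \<Rightarrow> real"
  assumes good: "good_measurable_space M"
    and extended: "extended_to_all_Lp M P"
    and conserv: "conservative M P"
    and kernel: "heat_kernel M P p"

section \<open>Heat semigroup based Besov spaces and functions of bounded variation\<close>

text \<open>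
  \<open>P\<^sub>t g (y)\<close> for nonnegative measurable \<open>g\<close>, through the heat kernel. The kernel gives the
  pointwise value needed when the function \<open>g\<close> itself depends on the evaluation point \<open>y\<close>.
\<close>

definition heat_apply ::
    "'a measure \<Rightarrow> (real \<Rightarrow> 'a \<Rightarrow> 'a \<Rightarrow> real) \<Rightarrow> real \<Rightarrow> ('a \<Rightarrow> real) \<Rightarrow> 'a \<Rightarrow> ennreal" where
  "heat_apply M p t g y = (\<integral>\<^sup>+x. ennreal (p t y x * g x) \<partial>M)"

definition heat_variation ::
    "'a measure \<Rightarrow> (real \<Rightarrow> 'a \<Rightarrow> 'a \<Rightarrow> real) \<Rightarrow> real \<Rightarrow> ('a \<Rightarrow> real) \<Rightarrow> real \<Rightarrow> ennreal" where
  "heat_variation M p \<alpha> f t =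
     ennreal (t powr (-\<alpha>)) * (\<integral>\<^sup>+y. heat_apply M p t (\<lambda>x. \<bar>f x - f y\<bar>) y \<partial>M)"

definition besov1 ::
    "'a measure \<Rightarrow> (real \<Rightarrow> 'a \<Rightarrow> 'a \<Rightarrow> real) \<Rightarrow> real \<Rightarrow> ('a \<Rightarrow> real) set" where
  "besov1 M p \<alpha> = {f \<in> Lp M 1. Limsup (at_right 0) (heat_variation M p \<alpha> f) < \<infinity>}"

definition AE_constant :: "'a measure \<Rightarrow> ('a \<Rightarrow> real) \<Rightarrow> bool" where
  "AE_constant M f \<longleftrightarrow> (\<exists>c. AE x in M. f x = c)"

text \<open>The supremum is taken in \<open>[0,\<infinity>]\<close>; it is \<open>0\<close> if no \<open>\<alpha> > 0\<close> qualifies.\<close>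

definition critical_exponent ::
    "'a measure \<Rightarrow> (real \<Rightarrow> 'a \<Rightarrow> 'a \<Rightarrow> real) \<Rightarrow> ennreal" where
  "critical_exponent M p =
     Sup {ennreal \<alpha> | \<alpha>. 0 < \<alpha> \<and> (\<exists>f\<in>besov1 M p \<alpha>. \<not> AE_constant M f)}"

text \<open>The following are meaningful only if the critical exponent is finite.\<close>

definition BV :: "'a measure \<Rightarrow> (real \<Rightarrow> 'a \<Rightarrow> 'a \<Rightarrow> real) \<Rightarrow> ('a \<Rightarrow> real) set" where
  "BV M p = besov1 M p (enn2real (critical_exponent M p))"

definition Var :: "'a measure \<Rightarrow> (real \<Rightarrow> 'a \<Rightarrow> 'a \<Rightarrow> real) \<Rightarrow> ('a \<Rightarrow> real) \<Rightarrow> ennreal" where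
  "Var M p f = Liminf (at_right 0) (heat_variation M p (enn2real (critical_exponent M p)) f)"

definition PPI1 ::
    "'a measure \<Rightarrow> (real \<Rightarrow> ('a \<Rightarrow> real) \<Rightarrow> 'a \<Rightarrow> real) \<Rightarrow> (real \<Rightarrow> 'a \<Rightarrow> 'a \<Rightarrow> real) \<Rightarrow> bool" where
  "PPI1 M P p \<longleftrightarrow>
     (\<exists>C>0. \<forall>t\<ge>0. \<forall>f\<in>BV M p.
        Lp_norm M 1 (\<lambda>x. P t f x - f x)
          \<le> ennreal (C * t powr enn2real (critical_exponent M p)) * Var M p f)"

end

theory Submission
  imports Defs
begin

text \<open>
  With the exponent of the heat kernel bound equal to the critical exponent, small sets do not have
  small perimeter: heuristically, the variation of the indicator function of a set of finite positive
  measure is bounded below by a positive constant, whatever the measure. A coarea inequality bounds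
  the integral over \<open>s > 0\<close> of the perimeters of the level sets \<open>{\<bar>f\<bar> > s}\<close> by \<open>Var f\<close>. So \<open>Var f\<close>
  is at least a multiple of the length of the interval of levels \<open>s\<close> for which \<open>{\<bar>f\<bar> > s}\<close> is not
  null, which is the essential supremum of \<open>\<bar>f\<bar>\<close>.

  Indicators of level sets need not belong to \<open>BV\<close>, so they are replaced by thin slabs
  \<open>min (\<bar>f\<bar> - s)\<^sub>+ h\<close>. As Lipschitz truncations these stay in \<open>BV\<close>, and the variations of stacked
  slabs add up to at most \<open>Var f\<close> (\<open>sum_Var_le\<close>): increments of the slabs add up to at most the
  increment of \<open>f\<close>, and lower limits are superadditive. This takes the place of the coarea
  inequality.

  For one slab, the kernel bound makes \<open>P\<^sub>t g\<close> at most half the height of the slab \<open>g\<close> at a time with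
  \<open>t\<^sup>\<beta>\<close> proportional to the measure \<open>a\<close> of the base. On the top of the slab \<open>P\<^sub>t g\<close> and \<open>g\<close> then
  differ by half the height, and the Poincare inequality bounds \<open>h\<close> times the measure \<open>a'\<close> of the top
  by a multiple of \<open>a Var g\<close> (\<open>slab_inequality\<close>). So the sum of \<open>h (a' / a)\<close> over all slabs is
  bounded by a multiple of \<open>Var f\<close>. The top of a slab is essentially the base of the next one. The
  product of the ratios thus telescopes to a value that is independent of the number \<open>N\<close> of slabs, so
  that their sum is at least \<open>N - O(1)\<close> (\<open>sum_ratios_ge\<close>), and with many thin slabs the sum of
  \<open>h (a' / a)\<close> is at least half of the total height.
\<close>

section \<open>Slicing the range of a function into slabs\<close>

text \<open>
  The part of \<open>\<bar>u\<bar>\<close> that lies between the levels \<open>s\<close> and \<open>s + h\<close>. The absolute value is built in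
  because signed functions are estimated through their modulus.
\<close>
definition slab :: "real \<Rightarrow> real \<Rightarrow> real \<Rightarrow> real" where
  "slab s h u = min (max (\<bar>u\<bar> - s) 0) h"

lemma slab_nonneg: "0 \<le> h \<Longrightarrow> 0 \<le> slab s h u"
  and slab_le: "slab s h u \<le> h"
  by (auto simp: slab_def)

lemma slab_pos_iff: "0 < h \<Longrightarrow> 0 < slab s h u \<longleftrightarrow> s < \<bar>u\<bar>"
  by (auto simp: slab_def)

lemma slab_le_abs: "0 \<le> s \<Longrightarrow> slab s h u \<le> \<bar>u\<bar>"
  by (auto simp: slab_def)

lemma slab_eq_heightI: "0 \<le> h \<Longrightarrow> s + h < \<bar>u\<bar> \<Longrightarrow> slab s h u = h"
  by (auto simp: slab_def)

lemma slab_mono: "\<bar>u\<bar> \<le> \<bar>v\<bar> \<Longrightarrow> slab s h u \<le> slab s h v"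
  by (auto simp: slab_def)

lemma slab_contraction: "\<bar>slab s h u - slab s h v\<bar> \<le> \<bar>u - v\<bar>"
  by (auto simp: slab_def min_def max_def abs_if)

lemma borel_measurable_slab [measurable]: "slab s h \<in> borel_measurable borel"
  unfolding slab_def by measurable

lemma sum_slab:
  assumes "0 \<le> h"
  shows "(\<Sum>k<N. slab (s + real k * h) h u) = slab s (real N * h) u"
proof (induction N)
  case 0
  then show ?case by (simp add: slab_def)
next
  case (Suc N)
  have "slab s (real N * h) u + slab (s + real N * h) h u = slab s (real N * h + h) u"
    using assms mult_nonneg_nonneg[of "real N" h]
    unfolding slab_def by linarith
  with Suc show ?case by (simp add: algebra_simps)
qed

text \<open>
  If \<open>\<bar>v\<bar> \<le> \<bar>u\<bar>\<close>, every slab is at least as large at \<open>u\<close> as at \<open>v\<close>, so the differences carry no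
  cancellation and the stack telescopes to one tall slab, which is a contraction.
\<close>
lemma sum_slab_differences_le:
  assumes "0 \<le> h"
  shows "(\<Sum>k<N. \<bar>slab (s + real k * h) h u - slab (s + real k * h) h v\<bar>) \<le> \<bar>u - v\<bar>"
proof -
  have ordered: "(\<Sum>k<N. \<bar>slab (s + real k * h) h u - slab (s + real k * h) h v\<bar>) \<le> \<bar>u - v\<bar>"
    if "\<bar>v\<bar> \<le> \<bar>u\<bar>" for u v
  proof -
    have "(\<Sum>k<N. \<bar>slab (s + real k * h) h u - slab (s + real k * h) h v\<bar>)
        = (\<Sum>k<N. slab (s + real k * h) h u - slab (s + real k * h) h v)"
      using slab_mono[OF that] by (intro sum.cong) auto
    also have "\<dots> = slab s (real N * h) u - slab s (real N * h) v"
      by (simp add: sum_subtractf sum_slab[OF assms])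
    also have "\<dots> \<le> \<bar>u - v\<bar>"
      using slab_contraction abs_le_D1 by blast
    finally show ?thesis .
  qed
  show ?thesis
    using ordered[of v u] ordered[of u v] by (cases "\<bar>v\<bar> \<le> \<bar>u\<bar>") (auto simp: abs_minus_commute)
qed

section \<open>Lower limits and Lebesgue norms\<close>

text \<open>
  The infima in the definition of the lower limit are directed in the event \<open>P\<close> along the filter, so
  the two suprema can be taken simultaneously.
\<close>
lemma Liminf_add_le_ennreal:
  fixes f g :: "'b \<Rightarrow> ennreal"
  shows "Liminf F f + Liminf F g \<le> Liminf F (\<lambda>x. f x + g x)"
proof -
  let ?I = "{P. eventually P F}" and ?inf = "\<lambda>f P. INF x\<in>Collect P. f x :: ennreal"
  have "Liminf F f + Liminf F g = (SUP P\<in>?I. ?inf f P + ?inf g P)"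
    unfolding Liminf_def
  proof (rule SUP_add_directed_ennreal[symmetric])
    fix P Q assume "P \<in> ?I" and "Q \<in> ?I"
    then show "\<exists>R\<in>?I. ?inf f P + ?inf g Q \<le> ?inf f R + ?inf g R"
      by (intro bexI[where x = "\<lambda>x. P x \<and> Q x"] add_mono INF_superset_mono) (auto intro: eventually_conj)
  qed
  also have "\<dots> \<le> (SUP P\<in>?I. ?inf (\<lambda>x. f x + g x) P)"
    by (intro SUP_mono' INF_greatest add_mono INF_lower)
  finally show ?thesis
    by (simp add: Liminf_def)
qed

lemma sum_Liminf_le:
  fixes f :: "'i \<Rightarrow> 'b \<Rightarrow> ennreal"
  assumes "finite I"
  shows "(\<Sum>i\<in>I. Liminf F (f i)) \<le> Liminf F (\<lambda>x. \<Sum>i\<in>I. f i x)"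
  using assms
proof (induction I)
  case empty
  then show ?case by simp
next
  case (insert i I)
  then have "(\<Sum>i\<in>insert i I. Liminf F (f i)) \<le> Liminf F (f i) + Liminf F (\<lambda>x. \<Sum>i\<in>I. f i x)"
    by (simp add: add_left_mono)
  also have "\<dots> \<le> Liminf F (\<lambda>x. \<Sum>i\<in>insert i I. f i x)"
    using Liminf_add_le_ennreal insert by simp
  finally show ?case .
qed

lemma Lp_norm_1: "Lp_norm M 1 f = (\<integral>\<^sup>+x. ennreal \<bar>f x\<bar> \<partial>M)"
  by (auto simp: Lp_norm_def Let_def ennreal_enn2real less_top)

lemma Lp_1_iff_integrable: "f \<in> Lp M 1 \<longleftrightarrow> integrable M f"
  by (auto simp: Lp_def Lp_norm_1 integrable_iff_bounded)

lemma bounded_Lp_1_imp_Lp_2: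
  assumes "f \<in> Lp M 1" and "\<And>x. \<bar>f x\<bar> \<le> h"
  shows "f \<in> Lp M 2"
proof -
  have int: "integrable M f" using assms(1) by (simp add: Lp_1_iff_integrable)
  have "0 \<le> h" using assms(2) abs_ge_zero order_trans by blast
  have "\<bar>f x\<bar> powr 2 \<le> h * \<bar>f x\<bar>" for x
    using mult_right_mono[OF assms(2)[of x], of "\<bar>f x\<bar>"] by (simp add: power2_eq_square)
  then have "(\<integral>\<^sup>+x. ennreal (\<bar>f x\<bar> powr 2) \<partial>M) \<le> (\<integral>\<^sup>+x. ennreal h * ennreal \<bar>f x\<bar> \<partial>M)"
    using \<open>0 \<le> h\<close>
    by (intro nn_integral_mono) (simp add: ennreal_mult[symmetric] ennreal_leI del: powr_numeral)
  also have "\<dots> = ennreal h * (\<integral>\<^sup>+x. ennreal \<bar>f x\<bar> \<partial>M)"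
    using int by (intro nn_integral_cmult) auto
  also have "\<dots> < \<infinity>"
    using int by (auto simp: integrable_iff_bounded ennreal_mult_less_top)
  finally show ?thesis
    using assms(1) by (auto simp: Lp_def Lp_norm_def Let_def)
qed

lemma finite_superlevel_set:
  assumes "f \<in> Lp M 1" and "0 < s"
  shows "emeasure M {x\<in>space M. s < \<bar>f x\<bar>} < \<infinity>"
proof -
  have [measurable]: "f \<in> borel_measurable M" using assms(1) by (simp add: Lp_def)
  have "emeasure M {x\<in>space M. s < \<bar>f x\<bar>} \<le> emeasure M {x\<in>space M. 1 \<le> ennreal (1 / s) * ennreal \<bar>f x\<bar>}"
    using assms(2)
    by (intro emeasure_mono) (auto simp: ennreal_mult[symmetric] field_simps simp flip: ennreal_1 intro!: ennreal_leI)
  also have "\<dots> \<le> ennreal (1 / s) * (\<integral>\<^sup>+x\<in>space M. ennreal \<bar>f x\<bar> \<partial>M)"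
    by (intro nn_integral_Markov_inequality) auto
  also have "\<dots> < \<infinity>"
    using assms(1) by (simp add: Lp_def Lp_norm_1 ennreal_mult_less_top)
  finally show ?thesis .
qed

section \<open>Heat variation of contractions\<close>

context dirichlet_space
begin

lemma heat_kernel_measurable [measurable]:
  assumes "0 < t"
  shows "(\<lambda>(x, y). p t x y) \<in> borel_measurable (M \<Otimes>\<^sub>M M)"
  using kernel assms unfolding heat_kernel_def by auto

lemma heat_kernel_nonneg: "0 < t \<Longrightarrow> x \<in> space M \<Longrightarrow> y \<in> space M \<Longrightarrow> 0 \<le> p t x y"
  using kernel unfolding heat_kernel_def by auto

text \<open>
  Since the kernel is nonnegative, the heat variation is monotone and additive in the increments
  \<open>\<bar>f x - f y\<bar>\<close>, and pointwise inequalities between increments carry over.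
\<close>
lemma sum_heat_variation_le:
  assumes "0 < t" and "finite I" and [measurable]: "\<And>i. i \<in> I \<Longrightarrow> g i \<in> borel_measurable M"
    and le: "\<And>x y. (\<Sum>i\<in>I. \<bar>g i x - g i y\<bar>) \<le> \<bar>f x - f y\<bar>"
  shows "(\<Sum>i\<in>I. heat_variation M p \<alpha> (g i) t) \<le> heat_variation M p \<alpha> f t"
proof -
  note [measurable] = heat_kernel_measurable[OF assms(1)]
  have inner: "(\<lambda>x. ennreal (p t y x * \<bar>g i x - g i y\<bar>)) \<in> borel_measurable M"
    if "i \<in> I" "y \<in> space M" for i y
    using that by measurable
  have outer: "(\<lambda>y. heat_apply M p t (\<lambda>x. \<bar>g i x - g i y\<bar>) y) \<in> borel_measurable M"
    if "i \<in> I" for i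
    unfolding heat_apply_def using that by measurable
  have pointwise: "(\<Sum>i\<in>I. heat_apply M p t (\<lambda>x. \<bar>g i x - g i y\<bar>) y)
      \<le> heat_apply M p t (\<lambda>x. \<bar>f x - f y\<bar>) y" if "y \<in> space M" for y
  proof -
    have "(\<Sum>i\<in>I. heat_apply M p t (\<lambda>x. \<bar>g i x - g i y\<bar>) y)
        = (\<integral>\<^sup>+x. (\<Sum>i\<in>I. ennreal (p t y x * \<bar>g i x - g i y\<bar>)) \<partial>M)"
      unfolding heat_apply_def using inner that by (intro nn_integral_sum[symmetric]) auto
    also have "\<dots> \<le> (\<integral>\<^sup>+x. ennreal (p t y x * \<bar>f x - f y\<bar>) \<partial>M)"
    proof (rule nn_integral_mono)
      fix x assume x: "x \<in> space M"
      have "(\<Sum>i\<in>I. ennreal (p t y x * \<bar>g i x - g i y\<bar>))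
          = ennreal (p t y x * (\<Sum>i\<in>I. \<bar>g i x - g i y\<bar>))"
        using heat_kernel_nonneg[OF assms(1) that x] by (simp add: sum_distrib_left)
      also have "\<dots> \<le> ennreal (p t y x * \<bar>f x - f y\<bar>)"
        using heat_kernel_nonneg[OF assms(1) that x] le by (intro ennreal_leI mult_left_mono)
      finally show "(\<Sum>i\<in>I. ennreal (p t y x * \<bar>g i x - g i y\<bar>)) \<le> ennreal (p t y x * \<bar>f x - f y\<bar>)" .
    qed
    finally show ?thesis unfolding heat_apply_def .
  qed
  have "(\<Sum>i\<in>I. \<integral>\<^sup>+y. heat_apply M p t (\<lambda>x. \<bar>g i x - g i y\<bar>) y \<partial>M)
      = (\<integral>\<^sup>+y. (\<Sum>i\<in>I. heat_apply M p t (\<lambda>x. \<bar>g i x - g i y\<bar>) y) \<partial>M)"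
    using outer by (intro nn_integral_sum[symmetric]) auto
  also have "\<dots> \<le> (\<integral>\<^sup>+y. heat_apply M p t (\<lambda>x. \<bar>f x - f y\<bar>) y \<partial>M)"
    using pointwise by (intro nn_integral_mono)
  finally show ?thesis
    unfolding heat_variation_def by (simp add: sum_distrib_left[symmetric] mult_left_mono)
qed

text \<open>
  The substitute for the coarea inequality. The heat variations at each fixed time add up in this way,
  and superadditivity of lower limits preserves the direction of the estimate.
\<close>
lemma sum_Var_le:
  assumes "finite I" and "\<And>i. i \<in> I \<Longrightarrow> g i \<in> borel_measurable M"
    and "\<And>x y. (\<Sum>i\<in>I. \<bar>g i x - g i y\<bar>) \<le> \<bar>f x - f y\<bar>"
  shows "(\<Sum>i\<in>I. Var M p (g i)) \<le> Var M p f"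
proof -
  let ?v = "heat_variation M p (enn2real (critical_exponent M p))"
  have "(\<Sum>i\<in>I. Var M p (g i)) \<le> Liminf (at_right 0) (\<lambda>t. \<Sum>i\<in>I. ?v (g i) t)"
    unfolding Var_def using assms(1) by (rule sum_Liminf_le)
  also have "\<dots> \<le> Var M p f"
    unfolding Var_def
    using eventually_at_right_less[of 0] sum_heat_variation_le[OF _ assms]
    by (intro Liminf_mono) (auto elim: eventually_mono)
  finally show ?thesis .
qed

lemma contraction_in_BV:
  assumes f: "f \<in> BV M p" and [measurable]: "g \<in> borel_measurable M"
    and "\<And>x. \<bar>g x\<bar> \<le> \<bar>f x\<bar>" and "\<And>x y. \<bar>g x - g y\<bar> \<le> \<bar>f x - f y\<bar>"
  shows "g \<in> BV M p"
proof -
  let ?v = "heat_variation M p (enn2real (critical_exponent M p))"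
  have "integrable M f" using f by (simp add: BV_def besov1_def Lp_1_iff_integrable)
  then have "integrable M g"
    by (rule Bochner_Integration.integrable_bound) (use assms(3) in auto)
  have "Limsup (at_right 0) (?v g) \<le> Limsup (at_right 0) (?v f)"
  proof (rule Limsup_mono)
    show "\<forall>\<^sub>F t in at_right 0. ?v g t \<le> ?v f t"
      using eventually_at_right_less[of 0] sum_heat_variation_le[where I = "{()}" and g = "\<lambda>_. g" and f = f] assms
      by (auto elim!: eventually_mono)
  qed
  with f \<open>integrable M g\<close> show ?thesis
    by (auto simp: BV_def besov1_def Lp_1_iff_integrable intro: le_less_trans)
qed

section \<open>The heat flow on a single slab\<close>

lemma heat_semigroup_ultracontractive:
  assumes "0 < t" and g: "g \<in> Lp M 1" "g \<in> Lp M 2" and "0 \<le> K"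
    and "AE (x, y) in M \<Otimes>\<^sub>M M. p t x y \<le> K"
  shows "AE x in M. \<bar>P t g x\<bar> \<le> K * (\<integral>y. \<bar>g y\<bar> \<partial>M)"
proof -
  interpret pair_sigma_finite M M ..
  have int: "integrable M (\<lambda>y. \<bar>g y\<bar>)" using g(1) by (simp add: Lp_1_iff_integrable)
  have bound: "AE x in M. AE y in M. p t x y \<le> K"
    using AE_pair[OF assms(5)] by simp
  have repr: "AE x in M. integrable M (\<lambda>y. p t x y * g y) \<and> P t g x = (\<integral>y. p t x y * g y \<partial>M)"
    using kernel assms(1) g(2) unfolding heat_kernel_def by blast
  show ?thesis
    using bound repr AE_space
  proof eventually_elim
    case (elim x)
    have "\<bar>P t g x\<bar> \<le> (\<integral>y. \<bar>p t x y * g y\<bar> \<partial>M)"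
      using elim by simp
    also have "\<dots> \<le> (\<integral>y. K * \<bar>g y\<bar> \<partial>M)"
    proof (rule integral_mono_AE)
      show "AE y in M. \<bar>p t x y * g y\<bar> \<le> K * \<bar>g y\<bar>"
        using elim(1) AE_space
      proof eventually_elim
        case (elim y)
        with heat_kernel_nonneg[OF assms(1) \<open>x \<in> space M\<close>, of y] show ?case
          by (auto simp: abs_mult intro: mult_right_mono)
      qed
    qed (use elim int in auto)
    finally show ?case by simp
  qed
qed

text \<open>
  A relative isoperimetric inequality: the mass of \<open>g\<close> is at most \<open>h\<close> times the measure of its base,
  so by ultracontractivity the heat flow brings \<open>g\<close> below \<open>h / 2\<close> within a time controlled by the
  base alone. The region \<open>g = h\<close> loses at least \<open>h / 2\<close> of height by then, and the Poincare
  inequality limits the total loss by \<open>t\<^sup>\<beta>\<close> times the variation. Because the decay exponent of the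
  kernel and the exponent in the Poincare inequality coincide, \<open>t\<^sup>\<beta>\<close> is linear in the measure of the
  base and the height cancels.
\<close>
lemma slab_inequality:
  assumes "0 < \<beta>" and crit: "critical_exponent M p = ennreal \<beta>"
    and "0 < K" and kernel_le: "\<And>t. 0 < t \<Longrightarrow> AE (x, y) in M \<Otimes>\<^sub>M M. p t x y \<le> K * t powr (-\<beta>)"
    and "0 \<le> C" and poincare: "\<And>t. 0 \<le> t \<Longrightarrow>
      Lp_norm M 1 (\<lambda>x. P t g x - g x)
        \<le> ennreal (C * t powr enn2real (critical_exponent M p)) * Var M p g"
    and g: "g \<in> BV M p" and g_range: "\<And>x. 0 \<le> g x" "\<And>x. g x \<le> h" and "0 < h"
    and fin: "emeasure M {x\<in>space M. 0 < g x} < \<infinity>" and "Var M p g < \<infinity>"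
  shows "h * measure M {x\<in>space M. g x = h}
    \<le> 4 * C * K * measure M {x\<in>space M. 0 < g x} * enn2real (Var M p g)"
proof -
  define a where "a = measure M {x\<in>space M. 0 < g x}"
  define V where "V = enn2real (Var M p g)"
  have V: "Var M p g = ennreal V" "0 \<le> V"
    using assms(12) by (auto simp: V_def less_top)
  have gL1: "g \<in> Lp M 1" using g by (simp add: BV_def besov1_def)
  then have int: "integrable M g" by (simp add: Lp_1_iff_integrable)
  then have [measurable]: "g \<in> borel_measurable M" by simp
  have gL2: "g \<in> Lp M 2"
    using gL1 by (rule bounded_Lp_1_imp_Lp_2[where h = h]) (use g_range in auto)
  have top_le: "measure M {x\<in>space M. g x = h} \<le> a"
    unfolding a_def using \<open>0 < h\<close> fin by (intro measure_mono_fmeasurable) (auto simp: fmeasurable_def)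
  have top_fin: "emeasure M {x\<in>space M. g x = h} < \<infinity>"
    using \<open>0 < h\<close> by (intro le_less_trans[OF emeasure_mono fin]) auto
  show ?thesis
  proof (cases "a = 0")
    case True
    with top_le have "measure M {x\<in>space M. g x = h} = 0" by (simp add: measure_le_0_iff)
    with True show ?thesis unfolding a_def by simp
  next
    case False
    then have "0 < a" by (simp add: a_def less_le)
    \<comment> \<open>The time at which the bound \<open>K t\<^sup>-\<^sup>\<beta> h a\<close> for \<open>P\<^sub>t g\<close> equals \<open>h / 2\<close>.\<close>
    define t where "t = (2 * K * a) powr (1 / \<beta>)"
    have "0 < t" using \<open>0 < a\<close> \<open>0 < K\<close> by (simp add: t_def)
    have t_pow: "t powr \<beta> = 2 * K * a"
      using \<open>0 < a\<close> \<open>0 < K\<close> \<open>0 < \<beta>\<close> by (simp add: t_def powr_powr)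
    have "integrable M (indicator {x\<in>space M. 0 < g x} :: 'a \<Rightarrow> real)"
      using fin by (intro integrable_real_indicator) auto
    then have "(\<integral>x. \<bar>g x\<bar> \<partial>M) \<le> (\<integral>x. h * indicator {x\<in>space M. 0 < g x} x \<partial>M)"
      using int g_range
      by (intro integral_mono integrable_mult_right integrable_abs) (simp_all add: less_le split: split_indicator)
    also have "\<dots> = h * a" using fin by (simp add: a_def)
    finally have mass: "(\<integral>x. \<bar>g x\<bar> \<partial>M) \<le> h * a" .
    have "K * t powr (-\<beta>) * (\<integral>x. \<bar>g x\<bar> \<partial>M) \<le> K * t powr (-\<beta>) * (h * a)"
      using mass \<open>0 < K\<close> by (intro mult_left_mono) auto
    also have "\<dots> = h / 2"
      using \<open>0 < a\<close> \<open>0 < K\<close> by (simp add: powr_minus t_pow field_simps)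
    finally have half: "K * t powr (-\<beta>) * (\<integral>x. \<bar>g x\<bar> \<partial>M) \<le> h / 2" .
    have small: "AE x in M. \<bar>P t g x\<bar> \<le> K * t powr (-\<beta>) * (\<integral>y. \<bar>g y\<bar> \<partial>M)"
      using \<open>0 < K\<close> by (intro heat_semigroup_ultracontractive \<open>0 < t\<close> gL1 gL2 kernel_le) auto
    have "ennreal (h / 2 * measure M {x\<in>space M. g x = h})
        = (\<integral>\<^sup>+x. ennreal (h / 2) * indicator {x\<in>space M. g x = h} x \<partial>M)"
      using top_fin \<open>0 < h\<close>
      by (simp add: nn_integral_cmult_indicator emeasure_eq_ennreal_measure less_top
          flip: ennreal_mult)
    also have "\<dots> \<le> Lp_norm M 1 (\<lambda>x. P t g x - g x)"
      unfolding Lp_norm_1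
    proof (rule nn_integral_mono_AE)
      show "AE x in M. ennreal (h / 2) * indicator {x\<in>space M. g x = h} x \<le> ennreal \<bar>P t g x - g x\<bar>"
        using small
      proof eventually_elim
        case (elim x)
        with half have "\<bar>P t g x\<bar> \<le> h / 2" by linarith
        then show ?case by (auto simp: indicator_def intro!: ennreal_leI)
      qed
    qed
    also have "\<dots> \<le> ennreal (C * (2 * K * a)) * Var M p g"
      using poincare[of t] \<open>0 < t\<close> \<open>0 < \<beta>\<close> by (simp add: crit t_pow)
    also have "\<dots> = ennreal (C * (2 * K * a) * V)"
      using V \<open>0 < a\<close> \<open>0 < K\<close> \<open>0 \<le> C\<close> by (simp add: ennreal_mult)
    finally have "h / 2 * measure M {x\<in>space M. g x = h} \<le> C * (2 * K * a) * V"
      using V \<open>0 < a\<close> \<open>0 < K\<close> \<open>0 \<le> C\<close> by (subst (asm) ennreal_le_iff) auto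
    then show ?thesis by (simp add: a_def V_def)
  qed
qed

end

section \<open>Summation over all slabs\<close>

text \<open>
  By \<open>1 + ln r \<le> r\<close>. The logarithm telescopes, so the deficit from \<open>N\<close> depends on the two end values
  only: however fast a positive sequence decays between them, most of many ratios are close to \<open>1\<close>.
\<close>
lemma sum_ratios_ge:
  fixes a :: "nat \<Rightarrow> real"
  assumes "\<And>k. k \<le> N \<Longrightarrow> 0 < a k"
  shows "real N + ln (a N / a 0) \<le> (\<Sum>k<N. a (Suc k) / a k)"
proof -
  have "real N + ln (a N / a 0) = (\<Sum>k<N. 1 + (ln (a (Suc k)) - ln (a k)))"
    using assms[of 0] assms[of N] by (simp add: sum.distrib sum_lessThan_telescope[of "\<lambda>k. ln (a k)"] ln_div)
  also have "\<dots> \<le> (\<Sum>k<N. a (Suc k) / a k)"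
  proof (rule sum_mono)
    fix k assume "k \<in> {..<N}"
    then have pos: "0 < a (Suc k)" "0 < a k" using assms by auto
    then show "1 + (ln (a (Suc k)) - ln (a k)) \<le> a (Suc k) / a k"
      using ln_le_minus_one[of "a (Suc k) / a k"] by (simp add: ln_div)
  qed
  finally show ?thesis .
qed

text \<open>
  If \<open>\<bar>f\<bar>\<close> exceeded the bound on a set of positive measure, the range between a small positive level
  \<open>s\<close> (positive so that the level sets have finite measure) and the bound could be cut into \<open>N\<close> slabs
  with bases of positive measure. For large \<open>N\<close> the slab inequalities then add up to more variation
  than \<open>f\<close> has.
\<close>
lemma (in dirichlet_space) AE_abs_le_Var:
  assumes "0 < \<beta>" and crit: "critical_exponent M p = ennreal \<beta>"
    and "0 < K" and kernel_le: "\<And>t. 0 < t \<Longrightarrow> AE (x, y) in M \<Otimes>\<^sub>M M. p t x y \<le> K * t powr (-\<beta>)"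
    and "0 \<le> C" and poincare: "\<And>t f. 0 \<le> t \<Longrightarrow> f \<in> BV M p \<Longrightarrow>
      Lp_norm M 1 (\<lambda>x. P t f x - f x)
        \<le> ennreal (C * t powr enn2real (critical_exponent M p)) * Var M p f"
    and f: "f \<in> BV M p" and Vfin: "Var M p f < \<infinity>" and "0 < \<epsilon>"
  shows "AE x in M. \<bar>f x\<bar> \<le> 8 * C * K * enn2real (Var M p f) + \<epsilon>"
proof (rule ccontr)
  define V where "V = enn2real (Var M p f)"
  have V: "Var M p f = ennreal V" "0 \<le> V"
    using Vfin by (auto simp: V_def less_top)
  define D where "D = 8 * C * K * V"
  have "0 \<le> D" using assms V by (simp add: D_def)
  \<comment> \<open>Any \<open>s\<close> strictly between \<open>0\<close> and \<open>\<epsilon>\<close> makes the total height \<open>L\<close> of the slabs exceed \<open>D\<close>.\<close>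
  define s where "s = \<epsilon> / 4"
  define L where "L = D + \<epsilon> - s"
  have "0 < s" "0 < L" "D < L" using \<open>0 < \<epsilon>\<close> \<open>0 \<le> D\<close> by (auto simp: s_def L_def)
  define \<mu> where "\<mu> r = measure M {x\<in>space M. r < \<bar>f x\<bar>}" for r
  have fL1: "f \<in> Lp M 1" using f by (simp add: BV_def besov1_def)
  then have [measurable]: "f \<in> borel_measurable M" by (simp add: Lp_def)
  have fin: "emeasure M {x\<in>space M. r < \<bar>f x\<bar>} < \<infinity>" if "0 < r" for r
    using finite_superlevel_set[OF fL1 that] .
  have \<mu>_mono: "\<mu> r' \<le> \<mu> r" if "0 < r" "r \<le> r'" for r r'
    unfolding \<mu>_def using that fin[OF that(1)]
    by (intro measure_mono_fmeasurable) (auto simp: fmeasurable_def)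
  assume "\<not> (AE x in M. \<bar>f x\<bar> \<le> 8 * C * K * enn2real (Var M p f) + \<epsilon>)"
  then have "emeasure M {x\<in>space M. s + L < \<bar>f x\<bar>} \<noteq> 0"
    by (subst (asm) AE_iff_measurable[OF _ refl]) (auto simp: L_def D_def V_def not_le)
  then have "0 < \<mu> (s + L)"
    using fin[of "s + L"] \<open>0 < s\<close> \<open>0 < L\<close>
    by (auto simp: \<mu>_def less_le measure_def enn2real_eq_0_iff)
  \<comment> \<open>So many slabs that the logarithmic deficit costs at most half of the sum of the ratios.\<close>
  define N where "N = Suc (nat \<lceil>2 * \<bar>ln (\<mu> (s + L) / \<mu> s)\<bar>\<rceil>)"
  have N: "0 < N" "2 * \<bar>ln (\<mu> (s + L) / \<mu> s)\<bar> \<le> real N"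
    unfolding N_def by linarith+
  define h where "h = L / real N"
  have h: "0 < h" "real N * h = L" using N \<open>0 < L\<close> by (auto simp: h_def)
  define a where "a k = \<mu> (s + real k * h)" for k
  have level_pos: "0 < s + real k * h" for k
    using \<open>0 < s\<close> h by (simp add: add_pos_nonneg)
  have a_pos: "0 < a k" if "k \<le> N" for k
  proof -
    have "real k * h \<le> L"
      using that h by (metis less_imp_le mult_right_mono of_nat_mono)
    then have "\<mu> (s + L) \<le> a k"
      unfolding a_def using level_pos by (intro \<mu>_mono) auto
    with \<open>0 < \<mu> (s + L)\<close> show ?thesis by linarith
  qed
  define g where "g k x = slab (s + real k * h) h (f x)" for k x
  have [measurable]: "g k \<in> borel_measurable M" for k
    unfolding g_def by measurable
  have sum_Var: "(\<Sum>k<N. Var M p (g k)) \<le> Var M p f"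
    by (intro sum_Var_le) (use h sum_slab_differences_le in \<open>auto simp: g_def\<close>)
  have Var_g: "Var M p (g k) < \<infinity>" if "k < N" for k
    using sum_Var Vfin member_le_sum[of k "{..<N}" "\<lambda>k. Var M p (g k)"] that by auto
  have ratio: "h * (a (Suc k) / a k) \<le> 4 * C * K * enn2real (Var M p (g k))" if "k < N" for k
  proof -
    have gBV: "g k \<in> BV M p"
      by (rule contraction_in_BV[OF f])
        (use h level_pos[of k] slab_nonneg slab_le_abs slab_contraction in \<open>auto simp: g_def less_imp_le\<close>)
    have base: "{x\<in>space M. 0 < g k x} = {x\<in>space M. s + real k * h < \<bar>f x\<bar>}"
      using h by (simp add: g_def slab_pos_iff)
    have "a (Suc k) \<le> measure M {x\<in>space M. g k x = h}"
      unfolding a_def \<mu>_def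
    proof (rule measure_mono_fmeasurable)
      show "{x\<in>space M. s + real (Suc k) * h < \<bar>f x\<bar>} \<subseteq> {x\<in>space M. g k x = h}"
        using h by (auto simp: g_def algebra_simps intro!: slab_eq_heightI)
      have "emeasure M {x\<in>space M. g k x = h} \<le> emeasure M {x\<in>space M. 0 < g k x}"
        using h by (intro emeasure_mono) auto
      then show "{x\<in>space M. g k x = h} \<in> fmeasurable M"
        using fin[OF level_pos[of k]] by (auto simp: fmeasurable_def base)
    qed auto
    then have "h * a (Suc k) \<le> h * measure M {x\<in>space M. g k x = h}"
      using h by simp
    also have "\<dots> \<le> 4 * C * K * measure M {x\<in>space M. 0 < g k x} * enn2real (Var M p (g k))"
    proof (rule slab_inequality[OF assms(1-5) poincare[OF _ gBV] gBV])
      show "0 \<le> g k x" "g k x \<le> h" for x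
        using h by (simp_all add: g_def slab_nonneg slab_le)
    qed (use h fin[OF level_pos[of k]] Var_g[OF that] in \<open>simp_all add: base\<close>)
    also have "\<dots> = 4 * C * K * a k * enn2real (Var M p (g k))"
      by (simp add: base a_def \<mu>_def)
    finally show ?thesis
      using a_pos[of k] that by (simp add: field_simps)
  qed
  have "L / 2 \<le> h * (real N + ln (a N / a 0))"
  proof -
    have "real N / 2 \<le> real N + ln (a N / a 0)"
      using N h by (auto simp: a_def abs_le_iff)
    then have "h * (real N / 2) \<le> h * (real N + ln (a N / a 0))"
      using h by (intro mult_left_mono) auto
    then show ?thesis
      using h by (simp add: mult.commute[of h "real N"])
  qed
  also have "\<dots> \<le> h * (\<Sum>k<N. a (Suc k) / a k)"
    using sum_ratios_ge[OF a_pos] h by (intro mult_left_mono) auto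
  also have "\<dots> \<le> (\<Sum>k<N. 4 * C * K * enn2real (Var M p (g k)))"
    unfolding sum_distrib_left using ratio by (intro sum_mono) auto
  also have "\<dots> = 4 * C * K * (\<Sum>k<N. enn2real (Var M p (g k)))"
    by (simp add: sum_distrib_left)
  also have "(\<Sum>k<N. enn2real (Var M p (g k))) = enn2real (\<Sum>k<N. Var M p (g k))"
    using Var_g by (subst enn2real_sum) auto
  also have "4 * C * K * \<dots> \<le> 4 * C * K * V"
    unfolding V_def using sum_Var Vfin assms(3,5) by (intro mult_left_mono enn2real_mono) auto
  also have "\<dots> = D / 2" by (simp add: D_def)
  finally show False using \<open>D < L\<close> by simp
qed

theorem corollary4p6:
  fixes M :: "'a measure"
    and \<E> :: "('a \<Rightarrow> real) \<Rightarrow> ('a \<Rightarrow> real) \<Rightarrow> real"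
    and \<F> :: "('a \<Rightarrow> real) set"
    and P :: "real \<Rightarrow> ('a \<Rightarrow> real) \<Rightarrow> 'a \<Rightarrow> real"
    and p :: "real \<Rightarrow> 'a \<Rightarrow> 'a \<Rightarrow> real"
    and C\<^sub>h \<beta> :: real
  assumes "dirichlet_space M \<E> \<F> P p"
    and "C\<^sub>h > 0" and "\<beta> > 0"
    and "\<And>t. t > 0 \<Longrightarrow> AE (x, y) in M \<Otimes>\<^sub>M M. p t x y \<le> C\<^sub>h * t powr (-\<beta>)"
    and "PPI1 M P p"
    and "critical_exponent M p = ennreal \<beta>"
  shows "\<exists>C::real. C > 0 \<and> (\<forall>f\<in>BV M p. Lp_norm M \<infinity> f \<le> ennreal C * Var M p f)"
proof -
  interpret dirichlet_space M \<E> \<F> P p by fact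
  obtain C where "0 < C" and poincare: "\<And>t f. 0 \<le> t \<Longrightarrow> f \<in> BV M p \<Longrightarrow>
      Lp_norm M 1 (\<lambda>x. P t f x - f x)
        \<le> ennreal (C * t powr enn2real (critical_exponent M p)) * Var M p f"
    using assms(5) unfolding PPI1_def by blast
  define B where "B = 8 * C * C\<^sub>h"
  have "0 < B" using \<open>0 < C\<close> assms(2) by (simp add: B_def)
  moreover have "Lp_norm M \<infinity> f \<le> ennreal B * Var M p f" if f: "f \<in> BV M p" for f
  proof (rule ennreal_le_epsilon)
    fix \<epsilon> :: real
    assume top: "ennreal B * Var M p f < top" and "0 < \<epsilon>"
    have [measurable]: "f \<in> borel_measurable M"
      using f by (simp add: BV_def besov1_def Lp_def)
    have fin: "Var M p f < \<infinity>"
      using top \<open>0 < B\<close> by (auto simp: ennreal_mult_less_top)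
    have "AE x in M. \<bar>f x\<bar> \<le> B * enn2real (Var M p f) + \<epsilon>"
      unfolding B_def using assms poincare f fin \<open>0 < C\<close> \<open>0 < \<epsilon>\<close>
      by (intro AE_abs_le_Var[where \<beta> = \<beta>]) auto
    then have "AE x in M. ennreal \<bar>f x\<bar> \<le> ennreal (B * enn2real (Var M p f) + \<epsilon>)"
      by eventually_elim (rule ennreal_leI)
    also have "ennreal (B * enn2real (Var M p f) + \<epsilon>) = ennreal B * Var M p f + ennreal \<epsilon>"
      using \<open>0 < B\<close> \<open>0 < \<epsilon>\<close> fin by (simp add: ennreal_plus ennreal_mult less_top)
    finally show "Lp_norm M \<infinity> f \<le> ennreal B * Var M p f + ennreal \<epsilon>"
      unfolding Lp_norm_def by (auto intro!: esssup_I)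
  qed
  ultimately show ?thesis by blast
qed

end
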